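(* Let $V:\mathbb{R}^d\to\mathbb{R}$ satisfy the assumptions (V-a)–(V-d) and let the proximal function $d(\cdot,\cdot)$ satisfy the assumptions (D-a)–(D-c) listed in the context. Then for any compact subset $\Omega_1'$ of the index-1 region $\Omega_1=\{x\in\mathbb{R}^d:\lambda_1(x)<0<\lambda_2(x)\}$ and any two constants $\alpha,\beta\in\mathbb{R}$ with $\alpha+\beta>1$, there exists a constant $\bar\rho$, depending on $\alpha$, $\beta$ and $\Omega_1'$, such that for all $\rho>\bar\rho$ the optimization problem $$\min_{y\in\mathbb{R}^d}\widetilde W_\rho(y;x,\mathbf{v}_1(x)),\qquad \widetilde W_\rho(y;x,\mathbf{v}_1(x))=W(y;x,\mathbf{v}_1(x))+\rho\, d(x,y),$$ has a unique solution for each $x\in\Omega_1'$; that is, $\Phi_\rho(x)\neq\emptyset$ and $\Phi_\rho(x)$ is a singleton.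
   Context: Notation. For $V:\mathbb{R}^d\to\mathbb{R}$, $H(x)=\nabla^2V(x)$; $\lambda_1(x)\le\dots\le\lambda_d(x)$ are the eigenvalues of $H(x)$ in ascending order, and $\mathbf{v}_1(x)$ is the normalized eigenvector of $H(x)$ for its smallest eigenvalue $\lambda_1(x)$. $\lambda_{\min}(A),\lambda_{\max}(A)$ denote the smallest and largest eigenvalue of a symmetric matrix $A$. The letter $d$ denotes the dimension, while $d(\cdot,\cdot):\mathbb{R}^d\times\mathbb{R}^d\to\mathbb{R}$ denotes the proximal function. The penalty factor $\rho$ is a positive constant. For $x,y\in\mathbb{R}^d$ and a unit vector $\mathbf{u}$, $$W(y;x,\mathbf{u})=(1-\alpha)V(y)+\alpha V\big(y-\mathbf{u}\mathbf{u}^\top(y-x)\big)-\beta V\big(x+\mathbf{u}\mathbf{u}^\top(y-x)\big).$$ $\Phi_\rho(x)=\operatorname{argmin}_{y\in\mathbb{R}^d}\widetilde W_\rho(y;x,\mathbf{v}_1(x))$ is the set of all global minimizers (empty if there is none). $\mathcal{S}_1$ is the set of index-1 saddle points of $V$: all $x^*$ with $\nabla V(x^* )=0$ and $\lambda_1(x^* )<0<\lambda_2(x^* )\le\dots\le\lambda_d(x^* )$. Assumptions on $d(\cdot,\cdot)$: (D-a) for any $x$, $d(x,y)$ is convex and $C^2$ in $y$, and $\nabla_y^2d(x,y)=0$ if and only if $y=x$; (D-b) $d(x,y)\ge0$ for all $x,y$, and $d(x,y)=0$ if and only if $x=y$; (D-c) for any constant $\epsilon>0$ there is a positive constant $\bar\lambda_\epsilon>0$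 such that $\inf_{\|x-y\|\ge\epsilon}\lambda_{\min}(\nabla_y^2d(x,y))\ge\bar\lambda_\epsilon$. Assumptions on $V$: (V-a) $V\in\mathcal{C}^3(\mathbb{R}^d)$ and $V$ is Lipschitz continuous; (V-b) $\mathcal{S}_1$ is non-empty and finite; (V-c) $\nabla^2V$ is uniformly bounded: there are constants $\bar\lambda_L,\bar\lambda_U$ with $\bar\lambda_L\le\lambda_{\min}(\nabla^2V(x))\le\lambda_{\max}(\nabla^2V(x))\le\bar\lambda_U$ for all $x\in\mathbb{R}^d$; (V-d) all stationary points of $V$ are non-degenerate; that is, for all $x\in\mathbb{R}^d$ and $i\in\{1,\dots,d\}$, $\lambda_i(x)\ne0$, and $\lambda_i(x)\ne\lambda_j(x)$ for all $i\ne j$. *)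

theory Defs
  imports "HOL-Analysis.Analysis" "HOL-Computational_Algebra.Polynomial"
begin

definition grad :: "(real^'n \<Rightarrow> real) \<Rightarrow> real^'n \<Rightarrow> real^'n" where
  "grad f x = (THE g. GDERIV f x :> g)"

definition hess :: "(real^'n \<Rightarrow> real) \<Rightarrow> real^'n \<Rightarrow> real^'n^'n" where
  "hess f x = jacobian (grad f) (at x)"

primrec Ck :: "nat \<Rightarrow> (real^'n \<Rightarrow> real) \<Rightarrow> bool" where
  "Ck 0 f \<longleftrightarrow> continuous_on UNIV f"
| "Ck (Suc k) f \<longleftrightarrow>
     (\<exists>g :: real^'n \<Rightarrow> real^'n. (\<forall>x. GDERIV f x :> g x) \<and> (\<forall>i. Ck k (\<lambda>x. g x $ i)))"

definition charpoly :: "real^'n^'n \<Rightarrow> real poly" where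
  "charpoly A = det (mat [:0, 1:] - (\<chi> i j. [:A $ i $ j:]))"

(* Only real eigenvalues are collected, each with its multiplicity as a root of the
   characteristic polynomial; for a symmetric matrix the list has length CARD('n). *)
definition eigvals :: "real^'n^'n \<Rightarrow> real list" where
  "eigvals A = sorted_list_of_multiset (proots (charpoly A))"

definition lambda_min :: "real^'n^'n \<Rightarrow> real" where
  "lambda_min A = Min (set (eigvals A))"

definition lambda_max :: "real^'n^'n \<Rightarrow> real" where
  "lambda_max A = Max (set (eigvals A))"

(* The index i runs over 1, ..., CARD('n), whereas list positions start at 0. *)
definition lam :: "(real^'n \<Rightarrow> real) \<Rightarrow> nat \<Rightarrow> real^'n \<Rightarrow> real" where
  "lam V i x = eigvals (hess V x) ! (i - 1)"

(* Where the smallest eigenvalue is simple this is determined up to sign, and the sign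
   is immaterial below: the direction u enters W only through the projection u u^T. *)
definition v1 :: "(real^'n \<Rightarrow> real) \<Rightarrow> real^'n \<Rightarrow> real^'n" where
  "v1 V x = (SOME v. norm v = 1 \<and> hess V x *v v = lam V 1 x *\<^sub>R v)"

definition index1_region :: "(real^'n \<Rightarrow> real) \<Rightarrow> (real^'n) set" where
  "index1_region V = {x. lam V 1 x < 0 \<and> (\<forall>i\<in>{2..CARD('n)}. 0 < lam V i x)}"

definition index1_saddles :: "(real^'n \<Rightarrow> real) \<Rightarrow> (real^'n) set" where
  "index1_saddles V =
     {x. grad V x = 0 \<and> lam V 1 x < 0 \<and> (\<forall>i\<in>{2..CARD('n)}. 0 < lam V i x)}"

definition W :: "real \<Rightarrow> real \<Rightarrow> (real^'n \<Rightarrow> real) \<Rightarrow> real^'n \<Rightarrow> real^'n \<Rightarrow> real^'n \<Rightarrow> real" where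
  "W \<alpha> \<beta> V y x u =
     (1 - \<alpha>) * V y + \<alpha> * V (y - (u \<bullet> (y - x)) *\<^sub>R u) - \<beta> * V (x + (u \<bullet> (y - x)) *\<^sub>R u)"

definition W_pen :: "real \<Rightarrow> real \<Rightarrow> (real^'n \<Rightarrow> real) \<Rightarrow> (real^'n \<Rightarrow> real^'n \<Rightarrow> real)
    \<Rightarrow> real \<Rightarrow> real^'n \<Rightarrow> real^'n \<Rightarrow> real^'n \<Rightarrow> real" where
  "W_pen \<alpha> \<beta> V d \<rho> y x u = W \<alpha> \<beta> V y x u + \<rho> * d x y"

definition Phi :: "real \<Rightarrow> real \<Rightarrow> (real^'n \<Rightarrow> real) \<Rightarrow> (real^'n \<Rightarrow> real^'n \<Rightarrow> real)
    \<Rightarrow> real \<Rightarrow> real^'n \<Rightarrow> (real^'n) set" where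
  "Phi \<alpha> \<beta> V d \<rho> x =
     {y. \<forall>z. W_pen \<alpha> \<beta> V d \<rho> y x (v1 V x) \<le> W_pen \<alpha> \<beta> V d \<rho> z x (v1 V x)}"

(* The uniform bound in the last clause says that the infimum of lambda_min over all
   pairs at distance at least epsilon is at least l. *)
definition proximal :: "(real^'n \<Rightarrow> real^'n \<Rightarrow> real) \<Rightarrow> bool" where
  "proximal d \<longleftrightarrow>
     (\<forall>x. convex_on UNIV (d x) \<and> Ck 2 (d x) \<and> (\<forall>y. hess (d x) y = 0 \<longleftrightarrow> y = x)) \<and>
     (\<forall>x y. 0 \<le> d x y \<and> (d x y = 0 \<longleftrightarrow> x = y)) \<and>
     (\<forall>\<epsilon>>0. \<exists>l>0. \<forall>x y. \<epsilon> \<le> norm (x - y) \<longrightarrow> l \<le> lambda_min (hess (d x) y))"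

(* Non-degeneracy (nonzero, pairwise distinct eigenvalues) is required at the stationary
   points only.  Requiring it everywhere would be a stronger hypothesis, under which the
   index-1 region is the whole space. *)
definition admissible_potential :: "(real^'n \<Rightarrow> real) \<Rightarrow> bool" where
  "admissible_potential V \<longleftrightarrow>
     Ck 3 V \<and> (\<exists>L. L-lipschitz_on UNIV V) \<and>
     index1_saddles V \<noteq> {} \<and> finite (index1_saddles V) \<and>
     (\<exists>l u. \<forall>x. l \<le> lambda_min (hess V x) \<and> lambda_min (hess V x) \<le> lambda_max (hess V x) \<and>
               lambda_max (hess V x) \<le> u) \<and>
     (\<forall>x. grad V x = 0 \<longrightarrow>
        (\<forall>i\<in>{1..CARD('n)}. lam V i x \<noteq> 0) \<and>
        (\<forall>i\<in>{1..CARD('n)}. \<forall>j\<in>{1..CARD('n)}. i \<noteq> j \<longrightarrow> lam V i x \<noteq> lam V j x))"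

end

theory Submission
  imports Defs
begin

text \<open>
  The penalized function is strongly convex, uniformly over \<open>x \<in> \<Omega>\<close>, once \<open>\<rho>\<close> is large. At \<open>y = x\<close>
  the vector \<open>u = v\<^sub>1(x)\<close> is an eigenvector of \<open>H(x)\<close>, so the Hessian of \<open>W\<close> splits: on the orthogonal
  complement of \<open>u\<close> it is \<open>H(x)\<close>, which is positive there because \<open>\<lambda>\<^sub>2(x) > 0\<close>, and along \<open>u\<close> it is
  \<open>(1 - \<alpha> - \<beta>) \<lambda>\<^sub>1(x) > 0\<close>. Compactness extends a uniform positive lower bound to all \<open>y\<close> with
  \<open>\<parallel>y - x\<parallel> < \<epsilon>\<close>, where the Hessian of \<open>\<rho> d(x, \<cdot>)\<close> does no harm since it is positive semidefinite.
  For \<open>\<parallel>y - x\<parallel> \<ge> \<epsilon>\<close> the Hessian of \<open>W\<close> is bounded below and that of \<open>d(x, \<cdot>)\<close> is at least \<open>l > 0\<close>,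
  so a large \<open>\<rho>\<close> wins.
\<close>

subsection \<open>Eigenvalues of symmetric matrices\<close>

lemma inner_symmetric_matrix:
  fixes A :: "real^'n^'n"
  assumes "transpose A = A"
  shows "x \<bullet> (A *v y) = (A *v x) \<bullet> y"
  by (metis assms dot_lmul_matrix transpose_matrix_vector)

text \<open>A minimizer \<open>w\<close> of the quadratic form on the unit sphere of
  \<open>S\<close> is an eigenvector. Its residual \<open>r\<close> lies in \<open>S\<close> by
  invariance, and moving from \<open>w\<close> along \<open>- r\<close> would make the nonnegative
  form \<open>q\<close> negative unless \<open>r = 0\<close>.\<close>

lemma rayleigh_minimizer:
  fixes A :: "real^'n^'n" and S :: "(real^'n) set"
  assumes sym: "transpose A = A" and S: "subspace S" "S \<noteq> {0}"
    and inv: "\<And>v. v \<in> S \<Longrightarrow> A *v v \<in> S"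
  obtains w m where "w \<in> S" "norm w = 1" "A *v w = m *\<^sub>R w"
    "\<And>v. v \<in> S \<Longrightarrow> m * (norm v)\<^sup>2 \<le> v \<bullet> (A *v v)"
proof -
  have cl: "compact (S \<inter> sphere 0 1)"
    using S(1) by (simp add: closed_subspace closed_Int_compact)
  obtain z where z: "z \<in> S" "z \<noteq> 0"
    using S subspace_0 by blast
  have "z /\<^sub>R norm z \<in> S \<inter> sphere 0 1"
    using z S(1) by (simp add: subspace_scale)
  hence ne: "S \<inter> sphere 0 1 \<noteq> {}" by blast
  have "continuous_on (S \<inter> sphere 0 1) (\<lambda>v. v \<bullet> (A *v v))"
    by (intro continuous_intros linear_continuous_on linear_linear[THEN iffD1] matrix_vector_mul_linear)
  from continuous_attains_inf[OF cl ne this] obtain w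
    where w: "w \<in> S" "norm w = 1"
      and min: "\<And>v. v \<in> S \<Longrightarrow> norm v = 1 \<Longrightarrow> w \<bullet> (A *v w) \<le> v \<bullet> (A *v v)"
    by auto
  define m where "m = w \<bullet> (A *v w)"
  have ray: "m * (norm v)\<^sup>2 \<le> v \<bullet> (A *v v)" if v: "v \<in> S" for v
  proof (cases "v = 0")
    case False
    have "m \<le> (v /\<^sub>R norm v) \<bullet> (A *v (v /\<^sub>R norm v))"
      unfolding m_def using v False S(1) by (intro min) (auto simp: subspace_scale)
    also have "\<dots> = (v \<bullet> (A *v v)) / (norm v)\<^sup>2"
      by (simp add: matrix_vector_mult_scaleR divide_simps power2_eq_square)
    finally show ?thesis using False by (simp add: field_simps)
  qed simp
  define q where "q v = v \<bullet> (A *v v) - m * (v \<bullet> v)" for v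
  have q0: "0 \<le> q v" if "v \<in> S" for v
    using ray[OF that] by (simp add: q_def power2_norm_eq_inner)
  define r where "r = A *v w - m *\<^sub>R w"
  have rS: "r \<in> S"
    unfolding r_def using w inv S(1) by (intro subspace_diff subspace_scale) auto
  have ww: "w \<bullet> w = 1" using w by (simp add: norm_eq_1)
  \<comment> \<open>The constant term vanishes because \<open>q w = 0\<close>; symmetry of
    \<open>A\<close> turns the linear coefficient into the squared length of the residual.\<close>
  have qexp: "q (w - s *\<^sub>R r) = s\<^sup>2 * q r - 2 * s * (r \<bullet> r)" for s
  proof -
    have 1: "w \<bullet> (A *v r) = (A *v w) \<bullet> r" by (rule inner_symmetric_matrix[OF sym])
    have 2: "A *v w = r + m *\<^sub>R w" by (simp add: r_def)
    have 3: "r \<bullet> w = 0" unfolding r_def inner_diff_left by (simp add: ww m_def inner_commute)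
    show ?thesis unfolding q_def
      by (simp add: matrix_vector_mult_diff_distrib matrix_vector_mult_scaleR inner_diff_left
          inner_diff_right 1) (simp add: 2 3 ww inner_commute algebra_simps power2_eq_square)
  qed
  have "r \<bullet> r = 0"
  proof (rule ccontr)
    assume "r \<bullet> r \<noteq> 0"
    hence rr: "r \<bullet> r > 0" using inner_ge_zero[of r] by linarith
    have pos: "0 \<le> s\<^sup>2 * q r - 2 * s * (r \<bullet> r)" for s
      using q0[of "w - s *\<^sub>R r"] qexp w rS S(1) by (simp add: subspace_diff subspace_scale)
    have "q r \<noteq> 0" using pos[of 1] rr by (auto simp del: inner_gt_zero_iff inner_eq_zero_iff)
    hence qr: "q r > 0" using q0[OF rS] by linarith
    \<comment> \<open>This value of \<open>s\<close> minimizes the quadratic polynomial from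
      \<open>qexp\<close>.\<close>
    have "(r \<bullet> r / q r)\<^sup>2 * q r - 2 * (r \<bullet> r / q r) * (r \<bullet> r) = - ((r \<bullet> r)\<^sup>2 / q r)"
      using qr by (simp add: field_simps power2_eq_square)
    with pos[of "r \<bullet> r / q r"] have "(r \<bullet> r)\<^sup>2 / q r \<le> 0" by linarith
    thus False using rr qr by (simp add: divide_le_0_iff)
  qed
  hence "A *v w = m *\<^sub>R w" by (simp add: r_def)
  with w ray that show thesis by blast
qed

section \<open>Eigenvalues as roots of the characteristic polynomial\<close>

lemma poly_det: "poly (det M) t = det (\<chi> i j. poly (M $ i $ j) t)"
  by (simp add: det_def poly_sum poly_prod of_int_poly)

lemma poly_charpoly: "poly (charpoly A) t = det (mat t - A)"
  unfolding charpoly_def poly_det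
  by (rule arg_cong[where f = det]) (simp add: vec_eq_iff mat_def)

lemma det_eq_0_iff_kernel:
  fixes A :: "real^'n^'n"
  shows "det A = 0 \<longleftrightarrow> (\<exists>v. v \<noteq> 0 \<and> A *v v = 0)"
  by (metis invertible_det_nz invertible_left_inverse matrix_left_invertible_ker)

lemma poly_charpoly_eq_0_iff:
  "poly (charpoly A) m = 0 \<longleftrightarrow> (\<exists>v. v \<noteq> 0 \<and> A *v v = m *\<^sub>R v)"
proof -
  have "(mat m - A) *v v = m *\<^sub>R v - A *v v" for v
    using matrix_vector_mult_diff_rdistrib[of "mat m" A v]
    by (simp add: vec_eq_iff matrix_vector_mult_def mat_def if_distrib if_distribR cong: if_cong)
  thus ?thesis unfolding poly_charpoly det_eq_0_iff_kernel by auto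
qed

text \<open>A number above an operator norm bound is no eigenvalue, hence no root. Being nonzero is
  what identifies the members of \<open>proots\<close> with the zeros of the polynomial.\<close>

lemma charpoly_nonzero: "charpoly A \<noteq> 0"
proof -
  obtain B where B: "B > 0" "\<And>v. norm (A *v v) \<le> B * norm v"
    using linear_bounded_pos[OF matrix_vector_mul_linear[of A]] by blast
  have "poly (charpoly A) (B + 1) \<noteq> 0"
  proof
    assume "poly (charpoly A) (B + 1) = 0"
    then obtain v where v: "v \<noteq> 0" "A *v v = (B + 1) *\<^sub>R v"
      by (auto simp: poly_charpoly_eq_0_iff)
    have "(B + 1) * norm v \<le> B * norm v" using B(2)[of v] B(1) v(2) by simp
    thus False using v(1) by (simp add: algebra_simps)
  qed
  thus ?thesis by auto
qed

lemma set_eigvals: "set (eigvals A) = {m. \<exists>v. v \<noteq> 0 \<and> A *v v = m *\<^sub>R v}"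
  by (simp add: eigvals_def charpoly_nonzero poly_charpoly_eq_0_iff)

lemma eigvalsI: "norm v = 1 \<Longrightarrow> A *v v = m *\<^sub>R v \<Longrightarrow> m \<in> set (eigvals A)"
  unfolding set_eigvals mem_Collect_eq by (intro exI[of _ v]) auto

text \<open>The Rayleigh minimum over the whole space is itself a member of
  \<open>eigvals A\<close>, so \<open>Min\<close> lies below it.\<close>

lemma lambda_min_rayleigh:
  fixes A :: "real^'n^'n"
  assumes sym: "transpose A = A"
  shows "lambda_min A * (norm v)\<^sup>2 \<le> v \<bullet> (A *v v)"
proof -
  obtain w m where w: "norm w = 1" "A *v w = m *\<^sub>R w"
    and ray: "\<And>v. m * (norm v)\<^sup>2 \<le> v \<bullet> (A *v v)"
    by (rule rayleigh_minimizer[OF sym subspace_UNIV UNIV_not_singleton]) auto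
  have "m \<in> set (eigvals A)" using w by (rule eigvalsI)
  hence "lambda_min A \<le> m" by (simp add: lambda_min_def)
  thus ?thesis using ray[of v] mult_right_mono[of "lambda_min A" m "(norm v)\<^sup>2"] by simp
qed

text \<open>The Rayleigh minimum of \<open>- A\<close> is the negative of an eigenvalue of
  \<open>A\<close>.\<close>

lemma lambda_max_rayleigh:
  fixes A :: "real^'n^'n"
  assumes sym: "transpose A = A"
  shows "v \<bullet> (A *v v) \<le> lambda_max A * (norm v)\<^sup>2"
proof -
  have sym': "transpose (- A) = - A"
    using sym by (simp add: vec_eq_iff transpose_def)
  have neg: "(- A) *v v = - (A *v v)" for v
    by (simp add: vec_eq_iff matrix_vector_mult_def sum_negf)
  obtain w m where w: "norm w = 1" "(- A) *v w = m *\<^sub>R w"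
    and ray: "\<And>v. m * (norm v)\<^sup>2 \<le> v \<bullet> ((- A) *v v)"
    by (rule rayleigh_minimizer[OF sym' subspace_UNIV UNIV_not_singleton]) auto
  have "A *v w = (- m) *\<^sub>R w" using w(2) by (metis neg minus_minus scaleR_minus_left)
  hence "- m \<in> set (eigvals A)" using w(1) by (intro eigvalsI)
  hence "- m \<le> lambda_max A" by (simp add: lambda_max_def)
  thus ?thesis using ray[of v] mult_right_mono[of "- m" "lambda_max A" "(norm v)\<^sup>2"]
    by (simp add: neg)
qed

section \<open>Multiplicities and the sorted list of eigenvalues\<close>

lemma independent_orthogonal_pair:
  fixes u w :: "real^'n"
  assumes "u \<bullet> w = 0" "u \<noteq> 0" "w \<noteq> 0"
  shows "independent {u, w}" "u \<noteq> w"
proof -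
  show "u \<noteq> w" using assms by auto
  show "independent {u, w}"
    using assms by (intro pairwise_orthogonal_independent)
      (auto simp: pairwise_def orthogonal_def inner_commute)
qed

text \<open>The rows are a basis extending the pair; a kernel vector would be orthogonal to all of
  them, hence to itself.\<close>

lemma nonsingular_matrix_with_rows:
  fixes u w :: "real^'n"
  assumes "u \<bullet> w = 0" "u \<noteq> 0" "w \<noteq> 0"
  obtains B :: "real^'n^'n" and k l where "det B \<noteq> 0" "k \<noteq> l" "B $ k = u" "B $ l = w"
proof -
  note ind = independent_orthogonal_pair[OF assms]
  define E where "E = extend_basis {u, w}"
  have E: "{u, w} \<subseteq> E" "independent E" "span E = UNIV"
    unfolding E_def using ind(1) extend_basis_superset[OF ind(1)]
    by (auto simp: independent_extend_basis span_extend_basis)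
  have "card E = CARD('n)"
    using dim_span_eq_card_independent[OF E(2)] E(3) by simp
  moreover have "finite E" using E(2) independent_bound by blast
  ultimately obtain f :: "'n \<Rightarrow> real^'n" where f: "bij_betw f UNIV E"
    using finite_same_card_bij[of "UNIV :: 'n set" E] by auto
  obtain k l where kl: "f k = u" "f l = w"
    using f E(1) by (metis bij_betw_imp_surj_on imageE insert_subset)
  define B :: "real^'n^'n" where "B = (\<chi> i. f i)"
  have "det B \<noteq> 0"
  proof
    assume "det B = 0"
    then obtain v where v: "v \<noteq> 0" "B *v v = 0" unfolding det_eq_0_iff_kernel by blast
    have "f i \<bullet> v = 0" for i
      using v(2) by (simp add: vec_eq_iff matrix_vector_mul_component B_def)
    hence "\<And>e. e \<in> E \<Longrightarrow> orthogonal v e"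
      using f by (auto simp: bij_betw_def orthogonal_def inner_commute)
    hence "orthogonal v v" using E(3) by (metis UNIV_I orthogonal_to_span)
    thus False using v(1) by (simp add: orthogonal_def)
  qed
  moreover have "k \<noteq> l" using kl ind(2) by auto
  ultimately show thesis using that[of B k l] kl by (simp add: B_def)
qed

text \<open>Geometric multiplicity two forces algebraic multiplicity at least two, the one that
  \<open>eigvals\<close> counts. Multiplying \<open>tI - A\<close> from the left by an invertible
  \<open>B\<close> with rows \<open>u\<close> and \<open>w\<close> makes two rows divisible by
  \<open>t - m\<close>, so the square of this factor divides \<open>det B\<close> times the
  characteristic polynomial.\<close>

lemma order_charpoly_ge_2:
  fixes A :: "real^'n^'n"
  assumes sym: "transpose A = A" and uw: "u \<bullet> w = 0" "u \<noteq> 0" "w \<noteq> 0"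
    and eig: "A *v u = m *\<^sub>R u" "A *v w = m *\<^sub>R w"
  shows "2 \<le> order m (charpoly A)"
proof -
  obtain B :: "real^'n^'n" and k l where B: "det B \<noteq> 0" "k \<noteq> l" "B $ k = u" "B $ l = w"
    using nonsingular_matrix_with_rows[OF uw] .
  define C :: "real poly^'n^'n" where "C = (\<chi> i j. [:B $ i $ j:])"
  define M :: "real poly^'n^'n" where "M = mat [:0, 1:] - (\<chi> i j. [:A $ i $ j:])"
  define p :: "real poly" where "p = [:- m, 1:]"
  have symA: "A $ i $ j = A $ j $ i" for i j
    using sym by (metis transpose_def vec_lambda_beta)
  \<comment> \<open>By symmetry of \<open>A\<close>, a row of \<open>B\<close> that is an
    eigenvector is also a left eigenvector.\<close>
  have row: "(C ** M) $ i = p *s C $ i" if "A *v (B $ i) = m *\<^sub>R (B $ i)" for i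
  proof -
    have "(C ** M) $ i $ j = (p *s C $ i) $ j" for j
    proof -
      have "(C ** M) $ i $ j = (\<Sum>s\<in>UNIV. [:B $ i $ s:] * ((if s = j then [:0, 1:] else 0) - [:A $ s $ j:]))"
        by (simp add: matrix_matrix_mult_def C_def M_def mat_def)
      also have "\<dots> = [:B $ i $ j:] * [:0, 1:] - (\<Sum>s\<in>UNIV. [:A $ j $ s * B $ i $ s:])"
        by (simp add: right_diff_distrib sum_subtractf if_distrib[of "\<lambda>z. _ * z"] symA[of _ j] mult.commute
              cong: if_cong del: mult_pCons_left mult_pCons_right) (simp add: mult.commute)
      also have "(\<Sum>s\<in>UNIV. [:A $ j $ s * B $ i $ s:]) = [:(A *v (B $ i)) $ j:]"
        by (simp add: matrix_vector_mult_def sum_to_poly)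
      finally show ?thesis by (simp add: that C_def p_def)
    qed
    thus ?thesis by (simp add: vec_eq_iff)
  qed
  define c where "c i = (if i \<in> {k, l} then p else 1)" for i
  define D where "D i = (if i \<in> {k, l} then C $ i else (C ** M) $ i)" for i
  have "C ** M = (\<chi> i. c i *s D i)"
    using row[of k] row[of l] B eig
    unfolding vec_eq_iff[of "C ** M"] by (auto simp: c_def D_def)
  hence "det C * det M = prod c UNIV * det (\<chi> i. D i)"
    by (metis det_mul det_rows_mul)
  moreover have "prod c UNIV = (\<Prod>i\<in>{k, l}. p)"
    by (rule prod.mono_neutral_cong_right) (auto simp: c_def)
  ultimately have "p\<^sup>2 dvd det C * charpoly A"
    using B(2) by (simp add: power2_eq_square charpoly_def M_def)
  moreover have C: "poly (det C) m \<noteq> 0"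
    using B(1) by (simp add: poly_det C_def)
  ultimately have "2 \<le> order m (det C * charpoly A)"
    unfolding p_def order_divides using charpoly_nonzero[of A] by auto
  thus ?thesis
    using C charpoly_nonzero[of A] by (subst (asm) order_mult) (auto simp: order_0I)
qed

text \<open>If the second entry exceeded \<open>c\<close>, so would all later ones, leaving at most
  one entry that is at most \<open>c\<close>. Multiset inclusion makes \<open>a = b\<close> count
  twice.\<close>

lemma sorted_second_le:
  fixes L :: "'a::linorder list"
  assumes "sorted L" "{#a, b#} \<subseteq># mset L" "a \<le> c" "b \<le> c"
  shows "2 \<le> length L \<and> L ! 1 \<le> c"
proof -
  have "2 \<le> length L" using size_mset_mono[OF assms(2)] by simp
  then obtain x y zs where L: "L = x # y # zs"
    by (metis Suc_le_length_iff numeral_2_eq_2)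
  have "y \<le> c"
  proof (rule ccontr)
    assume "\<not> y \<le> c"
    hence zs: "filter_mset (\<lambda>z. z \<le> c) (mset zs) = {#}"
      using assms(1) L by (force simp: filter_mset_eq_conv)
    hence "size (filter_mset (\<lambda>z. z \<le> c) (mset L)) \<le> 1"
      using \<open>\<not> y \<le> c\<close> by (simp add: L zs)
    moreover have "{#a, b#} \<subseteq># filter_mset (\<lambda>z. z \<le> c) (mset L)"
      using multiset_filter_mono[OF assms(2), of "\<lambda>z. z \<le> c"] assms(3,4) by simp
    ultimately show False using size_mset_mono by fastforce
  qed
  with L show ?thesis by simp
qed

lemma eigvals_hd_eigenvector:
  fixes A :: "real^'n^'n"
  assumes sym: "transpose A = A"
  obtains u where "norm u = 1" "A *v u = (eigvals A ! 0) *\<^sub>R u"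
proof -
  obtain w m where w: "norm w = 1" "A *v w = m *\<^sub>R w"
    by (rule rayleigh_minimizer[OF sym subspace_UNIV UNIV_not_singleton]) auto
  have "m \<in> set (eigvals A)" using w by (rule eigvalsI)
  hence "eigvals A ! 0 \<in> set (eigvals A)"
    by (intro nth_mem) (auto simp: length_greater_0_conv[symmetric] simp del: length_greater_0_conv intro: length_pos_if_in_set)
  then obtain v where v: "v \<noteq> 0" "A *v v = (eigvals A ! 0) *\<^sub>R v"
    unfolding set_eigvals by blast
  show thesis
    by (rule that[of "v /\<^sub>R norm v"]) (use v in \<open>auto simp: matrix_vector_mult_scaleR\<close>)
qed

lemma index1_orthogonal_pos:
  fixes A :: "real^'n^'n"
  assumes sym: "transpose A = A"
    and pos: "\<forall>i\<in>{2..CARD('n)}. 0 < eigvals A ! (i - 1)"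
    and u: "norm u = 1" "A *v u = m *\<^sub>R u" "m \<le> 0"
    and v: "u \<bullet> v = 0" "v \<noteq> 0"
  shows "0 < v \<bullet> (A *v v)"
proof -
  define S where "S = {v. u \<bullet> v = 0}"
  have S: "subspace S" unfolding S_def by (rule subspace_hyperplane)
  have "A *v z \<in> S" if "z \<in> S" for z
    using that u(2) by (simp add: S_def inner_symmetric_matrix[OF sym])
  moreover have "v \<in> S" "S \<noteq> {0}" using v by (auto simp: S_def)
  ultimately obtain w m' where w: "w \<in> S" "norm w = 1" "A *v w = m' *\<^sub>R w"
    and ray: "\<And>v. v \<in> S \<Longrightarrow> m' * (norm v)\<^sup>2 \<le> v \<bullet> (A *v v)"
    using rayleigh_minimizer[OF sym S] by metis
  have nz: "u \<noteq> 0" "w \<noteq> 0" and uw: "u \<bullet> w = 0" using u(1) w by (auto simp: S_def)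
  have "0 < m'"
  proof (rule ccontr)
    assume "\<not> 0 < m'"
    hence m': "m' \<le> 0" by simp
    \<comment> \<open>Dimension at least two puts \<open>i = 2\<close> in the range of
      \<open>pos\<close>; list position 1 holds that eigenvalue.\<close>
    have n2: "2 \<le> CARD('n)"
      using independent_bound[of "{u, w}"] independent_orthogonal_pair[OF uw nz] by simp
    have "m \<in> set (eigvals A)" "m' \<in> set (eigvals A)"
      using u w by (auto intro: eigvalsI)
    moreover have "2 \<le> count (mset (eigvals A)) m" if "m = m'"
      using order_charpoly_ge_2[OF sym uw nz u(2)] w(3) that
      by (simp add: eigvals_def charpoly_nonzero)
    ultimately have "{#m, m'#} \<subseteq># mset (eigvals A)"
      by (auto simp: subseteq_mset_def Suc_le_eq)
    hence "eigvals A ! 1 \<le> 0"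
      using sorted_second_le[of "eigvals A" m m' 0] u(3) m' by (simp add: eigvals_def)
    moreover have "0 < eigvals A ! 1" using pos n2 by force
    ultimately show False by simp
  qed
  thus ?thesis using ray[OF \<open>v \<in> S\<close>] v(2) by (smt (verit) zero_less_mult_iff zero_less_norm_iff zero_less_power)
qed

subsection \<open>Twice continuously differentiable functions\<close>

lemma Ck_Suc_imp: "Ck (Suc k) f \<Longrightarrow> Ck k f"
proof (induction k arbitrary: f)
  case 0
  then obtain g where "\<And>x. GDERIV f x :> g x" by auto
  thus ?case
    by (auto simp: gderiv_def intro!: continuous_at_imp_continuous_on has_derivative_continuous)
next
  case (Suc k)
  from Suc.prems obtain g where "\<forall>x. GDERIV f x :> g x" "\<forall>i. Ck (Suc k) (\<lambda>x. g x $ i)"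
    unfolding Ck.simps(2)[of "Suc k"] by blast
  with Suc.IH show ?case by auto
qed

lemma grad_eqI:
  assumes "GDERIV f x :> g"
  shows "grad f x = g"
  unfolding grad_def
proof (rule the_equality, rule assms)
  fix g' assume "GDERIV f x :> g'"
  with assms have "(\<lambda>h. h \<bullet> g') = (\<lambda>h. h \<bullet> g)"
    unfolding gderiv_def by (rule has_derivative_unique[rotated])
  hence "\<forall>h. h \<bullet> g' = h \<bullet> g" by (simp add: fun_eq_iff)
  thus "g' = g" by (simp only: vector_eq_ldot)
qed

text \<open>Uniqueness of derivatives identifies \<open>grad\<close> and \<open>hess\<close> with
  the witnesses hidden in \<open>Ck\<close>, which carry differentiability and continuity.\<close>

lemma Ck2_derivatives:
  fixes f :: "real^'n \<Rightarrow> real"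
  assumes "Ck 2 f"
  shows GDERIV_grad: "GDERIV f x :> grad f x"
    and has_derivative_grad: "(grad f has_derivative (\<lambda>h. hess f x *v h)) (at x)"
    and continuous_on_hess: "continuous_on UNIV (hess f)"
proof -
  obtain g k where g: "\<And>x. GDERIV f x :> g x"
    and k: "\<And>i x. GDERIV (\<lambda>x. g x $ i) x :> k i x"
    and kc: "\<And>i j. continuous_on UNIV (\<lambda>x. k i x $ j)"
    using assms unfolding numeral_2_eq_2 Ck.simps by metis
  have gr: "grad f = g" using grad_eqI[OF g] by blast
  show "GDERIV f x :> grad f x" unfolding gr by (rule g)
  have "(g has_derivative (\<lambda>h. (\<chi> i j. k i x $ j) *v h)) (at x)" for x
  proof -
    have "((\<lambda>x. \<chi> i. g x $ i) has_derivative (\<lambda>h. \<chi> i. h \<bullet> k i x)) (at x)"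
      using k unfolding gderiv_def
      by (subst has_derivative_componentwise_within) (auto simp: Basis_vec_def inner_axis)
    moreover have "(\<chi> i. h \<bullet> k i x) = (\<chi> i j. k i x $ j) *v h" for h
      by (simp add: vec_eq_iff matrix_vector_mul_component inner_commute)
    ultimately show ?thesis by simp
  qed
  note D = this
  have H: "hess f x = (\<chi> i j. k i x $ j)" for x
    unfolding hess_def jacobian_def gr
    unfolding frechet_derivative_at[OF D, symmetric] by (rule matrix_of_matrix_vector_mul)
  show "(grad f has_derivative (\<lambda>h. hess f x *v h)) (at x)"
    unfolding gr H by (rule D)
  show "continuous_on UNIV (hess f)"
    unfolding H[abs_def] by (intro continuous_on_vec_lambda kc)
qed

lemma continuous_on_matrix_vector_mult [continuous_intros]:
  fixes A :: "'a::topological_space \<Rightarrow> real^'n^'m"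
  assumes "continuous_on S A" "continuous_on S v"
  shows "continuous_on S (\<lambda>x. A x *v v x)"
  unfolding matrix_vector_mult_def
  by (intro continuous_on_vec_lambda continuous_intros assms)

section \<open>Derivatives along lines and symmetry of the Hessian\<close>

lemma line_derivatives:
  fixes f :: "real^'n \<Rightarrow> real"
  assumes "Ck 2 f"
  shows line_deriv: "((\<lambda>t. f (a + t *\<^sub>R b)) has_real_derivative b \<bullet> grad f (a + t *\<^sub>R b)) (at t)"
    and line_deriv2: "((\<lambda>t. c \<bullet> grad f (a + t *\<^sub>R b)) has_real_derivative
      c \<bullet> (hess f (a + t *\<^sub>R b) *v b)) (at t)"
proof -
  have l: "((\<lambda>t. a + t *\<^sub>R b) has_derivative (\<lambda>t. t *\<^sub>R b)) (at t)"
    by (auto intro!: derivative_eq_intros)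
  show "((\<lambda>t. f (a + t *\<^sub>R b)) has_real_derivative b \<bullet> grad f (a + t *\<^sub>R b)) (at t)"
    using has_derivative_compose[OF l GDERIV_grad[OF assms, unfolded gderiv_def]]
    by (simp add: has_field_derivative_def mult.commute[of _ "b \<bullet> _"])
  show "((\<lambda>t. c \<bullet> grad f (a + t *\<^sub>R b)) has_real_derivative
      c \<bullet> (hess f (a + t *\<^sub>R b) *v b)) (at t)"
    using has_derivative_inner_right[OF has_derivative_compose[OF l has_derivative_grad[OF assms]], of c]
    by (simp add: has_field_derivative_def matrix_vector_mult_scaleR) (simp add: mult_commute_abs)
qed

text \<open>The mean value theorem is applied twice, first along \<open>u\<close> and then along
  \<open>v\<close>. The left-hand side is symmetric in \<open>u\<close> and
  \<open>v\<close>.\<close>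

lemma second_difference:
  fixes f :: "real^'n \<Rightarrow> real"
  assumes C2: "Ck 2 f" and s: "0 < s"
  shows "\<exists>y. norm (y - x) \<le> s * (norm u + norm v) \<and>
    f (x + s *\<^sub>R u + s *\<^sub>R v) - f (x + s *\<^sub>R u) - f (x + s *\<^sub>R v) + f x = s\<^sup>2 * (u \<bullet> (hess f y *v v))"
proof -
  define g where "g t = f ((x + s *\<^sub>R v) + t *\<^sub>R u) - f (x + t *\<^sub>R u)" for t
  have "\<exists>\<sigma>>0. \<sigma> < s \<and> g s - g 0 = (s - 0) *
      (u \<bullet> grad f ((x + s *\<^sub>R v) + \<sigma> *\<^sub>R u) - u \<bullet> grad f (x + \<sigma> *\<^sub>R u))"
    unfolding g_def using s by (intro MVT2 DERIV_diff line_deriv C2) auto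
  then obtain \<sigma> where \<sigma>: "0 < \<sigma>" "\<sigma> < s" "g s - g 0 = s *
      (u \<bullet> grad f ((x + s *\<^sub>R v) + \<sigma> *\<^sub>R u) - u \<bullet> grad f (x + \<sigma> *\<^sub>R u))" by auto
  define h where "h t = u \<bullet> grad f ((x + \<sigma> *\<^sub>R u) + t *\<^sub>R v)" for t
  have "\<exists>\<tau>>0. \<tau> < s \<and> h s - h 0 = (s - 0) * (u \<bullet> (hess f ((x + \<sigma> *\<^sub>R u) + \<tau> *\<^sub>R v) *v v))"
    unfolding h_def using s by (intro MVT2 line_deriv2 C2) auto
  then obtain \<tau> where \<tau>: "0 < \<tau>" "\<tau> < s"
    "h s - h 0 = s * (u \<bullet> (hess f ((x + \<sigma> *\<^sub>R u) + \<tau> *\<^sub>R v) *v v))" by auto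
  have "norm (\<sigma> *\<^sub>R u + \<tau> *\<^sub>R v) \<le> \<sigma> * norm u + \<tau> * norm v"
    using norm_triangle_ineq[of "\<sigma> *\<^sub>R u" "\<tau> *\<^sub>R v"] \<sigma> \<tau> by simp
  also have "\<dots> \<le> s * norm u + s * norm v"
    using \<sigma> \<tau> by (intro add_mono mult_right_mono) auto
  finally have "norm ((x + \<sigma> *\<^sub>R u) + \<tau> *\<^sub>R v - x) \<le> s * (norm u + norm v)"
    by (simp add: algebra_simps)
  moreover have "f (x + s *\<^sub>R u + s *\<^sub>R v) - f (x + s *\<^sub>R u) - f (x + s *\<^sub>R v) + f x = g s - g 0"
    by (simp add: g_def algebra_simps)
  moreover have "g s - g 0 = s * (h s - h 0)"
    unfolding \<sigma>(3) h_def by (simp add: algebra_simps)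
  ultimately show ?thesis using \<tau>(3) by (intro exI[of _ "(x + \<sigma> *\<^sub>R u) + \<tau> *\<^sub>R v"]) (simp add: power2_eq_square)
qed

text \<open>Schwarz's theorem: one second difference is evaluated in both orders, and continuity of
  the Hessian carries the equality of the two mixed forms to \<open>x\<close>.\<close>

lemma hess_symmetric:
  fixes f :: "real^'n \<Rightarrow> real"
  assumes C2: "Ck 2 f"
  shows "transpose (hess f x) = hess f x"
proof -
  have bil: "u \<bullet> (hess f x *v v) = v \<bullet> (hess f x *v u)" for u v
  proof (rule ccontr)
    assume neq: "u \<bullet> (hess f x *v v) \<noteq> v \<bullet> (hess f x *v u)"
    \<comment> \<open>Half the gap: two values, each within \<open>e\<close> of its own limit,
      cannot coincide.\<close>
    define e where "e = \<bar>u \<bullet> (hess f x *v v) - v \<bullet> (hess f x *v u)\<bar> / 2"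
    have e: "e > 0" using neq by (simp add: e_def)
    have "isCont (\<lambda>y. a \<bullet> (hess f y *v b)) x" for a b
      using continuous_on_hess[OF C2]
      by (intro continuous_on_interior[of UNIV]) (auto intro!: continuous_intros)
    hence "\<exists>\<delta>>0. \<forall>y. dist y x < \<delta> \<longrightarrow> \<bar>a \<bullet> (hess f y *v b) - a \<bullet> (hess f x *v b)\<bar> < e" for a b
      using e unfolding continuous_at_eps_delta dist_real_def by blast
    then obtain \<delta>1 \<delta>2 where \<delta>: "\<delta>1 > 0" "\<delta>2 > 0"
      "\<And>y. dist y x < \<delta>1 \<Longrightarrow> \<bar>u \<bullet> (hess f y *v v) - u \<bullet> (hess f x *v v)\<bar> < e"
      "\<And>y. dist y x < \<delta>2 \<Longrightarrow> \<bar>v \<bullet> (hess f y *v u) - v \<bullet> (hess f x *v u)\<bar> < e"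
      by metis
    \<comment> \<open>The summand 1 makes \<open>N\<close> positive and the estimate
      \<open>small\<close> strict.\<close>
    define N where "N = norm u + norm v + 1"
    define s where "s = min \<delta>1 \<delta>2 / N"
    have N: "N > 0" unfolding N_def by (smt (verit) norm_ge_zero)
    have s: "s > 0" using \<delta> N by (simp add: s_def)
    have small: "s * (norm u + norm v) < min \<delta>1 \<delta>2"
    proof -
      have "s * (norm u + norm v) < s * N" using s by (simp add: N_def)
      thus ?thesis using N by (simp add: s_def)
    qed
    obtain y z where y: "norm (y - x) \<le> s * (norm u + norm v)"
      "f (x + s *\<^sub>R u + s *\<^sub>R v) - f (x + s *\<^sub>R u) - f (x + s *\<^sub>R v) + f x = s\<^sup>2 * (u \<bullet> (hess f y *v v))"
      and z: "norm (z - x) \<le> s * (norm v + norm u)"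
      "f (x + s *\<^sub>R v + s *\<^sub>R u) - f (x + s *\<^sub>R v) - f (x + s *\<^sub>R u) + f x = s\<^sup>2 * (v \<bullet> (hess f z *v u))"
      using second_difference[OF C2 s] by metis
    have "s\<^sup>2 * (u \<bullet> (hess f y *v v)) = s\<^sup>2 * (v \<bullet> (hess f z *v u))"
      unfolding y(2)[symmetric] z(2)[symmetric] by (simp add: algebra_simps)
    hence "u \<bullet> (hess f y *v v) = v \<bullet> (hess f z *v u)" using s by simp
    moreover have "dist y x < \<delta>1" "dist z x < \<delta>2"
      using y(1) z(1) small by (auto simp: dist_norm add.commute)
    ultimately show False
      using \<delta>(3)[of y] \<delta>(4)[of z] unfolding e_def by (simp add: abs_if split: if_splits)
  qed
  have "hess f x $ i $ j = hess f x $ j $ i" for i j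
    using bil[of "axis i 1" "axis j 1"] by (simp add: inner_axis' matrix_vector_mul_component inner_axis)
  thus ?thesis by (simp add: vec_eq_iff transpose_def)
qed

text \<open>Taylor's formula along lines gives quadratic growth above every tangent. At 0 this is
  coercivity, hence existence; at a minimizer the tangent is constant, hence uniqueness.\<close>

lemma strongly_convex_unique_minimizer:
  fixes f :: "'a::euclidean_space \<Rightarrow> real"
  assumes m: "0 < m" and diff: "\<And>x. f differentiable (at x)"
    and line: "\<And>p q. \<exists>D D2. \<forall>t. ((\<lambda>t. f (p + t *\<^sub>R q)) has_real_derivative D t) (at t) \<and>
        (D has_real_derivative D2 t) (at t) \<and> m * (norm q)\<^sup>2 \<le> D2 t"
  shows "\<exists>!y. \<forall>z. f y \<le> f z"
proof -
  have growth: "f p + D q + m / 2 * (norm q)\<^sup>2 \<le> f (p + q)"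
    if D: "(f has_derivative D) (at p)" for p q D
  proof -
    obtain \<phi> \<phi>2 where \<phi>: "\<And>t. ((\<lambda>t. f (p + t *\<^sub>R q)) has_real_derivative \<phi> t) (at t)"
      "\<And>t. (\<phi> has_real_derivative \<phi>2 t) (at t)" "\<And>t. m * (norm q)\<^sup>2 \<le> \<phi>2 t"
      using line[of p q] by metis
    \<comment> \<open>The sequence of derivatives in the format of \<open>Taylor_up\<close>.\<close>
    define d where "d k = (if k = 0 then (\<lambda>t. f (p + t *\<^sub>R q)) else if k = Suc 0 then \<phi> else \<phi>2)" for k
    have "\<exists>t>0. t < 1 \<and> f (p + 1 *\<^sub>R q) =
        (\<Sum>k<2. d k 0 / fact k * (1 - 0) ^ k) + d 2 t / fact 2 * (1 - 0) ^ 2"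
      by (rule Taylor_up[where a = 0 and b = 1]) (use \<phi> in \<open>auto simp: d_def less_2_cases_iff\<close>)
    then obtain t where t: "f (p + q) = f p + \<phi> 0 + \<phi>2 t / 2"
      by (auto simp: d_def numeral_2_eq_2)
    have "((\<lambda>t. p + t *\<^sub>R q) has_derivative (\<lambda>t. t *\<^sub>R q)) (at 0)"
      by (auto intro!: derivative_eq_intros)
    hence "((\<lambda>t. f (p + t *\<^sub>R q)) has_derivative (\<lambda>t. D (t *\<^sub>R q))) (at 0)"
      by (rule has_derivative_compose) (use D in simp)
    moreover have "D (t *\<^sub>R q) = D q * t" for t
      using linear_scale[OF has_derivative_linear[OF D]] by simp
    ultimately have "((\<lambda>t. f (p + t *\<^sub>R q)) has_real_derivative D q) (at 0)"
      by (simp add: has_field_derivative_def)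
    \<comment> \<open>The first-order term comes from the line hypothesis; uniqueness ties it to the
      given derivative \<open>D\<close>.\<close>
    hence "\<phi> 0 = D q" using \<phi>(1) DERIV_unique by blast
    thus ?thesis using t \<phi>(3)[of t] by simp
  qed
  obtain D where D: "(f has_derivative D) (at 0)"
    using diff differentiable_def by blast
  obtain K where K: "K > 0" "\<And>q. norm (D q) \<le> K * norm q"
    using linear_bounded_pos[OF has_derivative_linear[OF D]] by blast
  \<comment> \<open>Beyond this radius the quadratic term \<open>m / 2 * (norm q)\<^sup>2\<close>
    dominates the linear term, bounded by \<open>K * norm q\<close>.\<close>
  define R where "R = 2 * K / m"
  have far: "f 0 \<le> f q" if "R \<le> norm q" for q
  proof -
    have "0 \<le> (m / 2 * norm q - K) * norm q"
      using that m by (intro mult_nonneg_nonneg) (auto simp: R_def field_simps)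
    also have "\<dots> \<le> m / 2 * (norm q)\<^sup>2 + D q"
      using K(2)[of q] by (simp add: algebra_simps power2_eq_square)
    finally show ?thesis using growth[OF D, of q] by simp
  qed
  have cont: "continuous_on (cball 0 R) f"
    using diff by (intro continuous_at_imp_continuous_on) (auto intro: differentiable_imp_continuous_within)
  have R: "0 < R" using K m by (simp add: R_def)
  have "cball 0 R \<noteq> ({} :: 'a set)" using R by simp
  then obtain y where y: "\<And>z. z \<in> cball 0 R \<Longrightarrow> f y \<le> f z"
    using continuous_attains_inf[OF compact_cball _ cont] by blast
  \<comment> \<open>Outside the ball, \<open>f z\<close> is at least \<open>f 0\<close>, and 0
    belongs to the ball.\<close>
  have glob: "f y \<le> f z" for z
    using y[of z] y[of 0] far[of z] R by (cases "norm z \<le> R") auto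
  show ?thesis
  proof (rule ex1I[of _ y])
    show "\<forall>z. f y \<le> f z" using glob by blast
    fix y' assume y': "\<forall>z. f y' \<le> f z"
    obtain D' where D': "(f has_derivative D') (at y')"
      using diff differentiable_def by blast
    have "D' = (\<lambda>_. 0)"
      using y' by (intro has_derivative_local_min[OF D']) auto
    with growth[OF D', of "y - y'"] have "f y' + m / 2 * (norm (y - y'))\<^sup>2 \<le> f y" by simp
    with glob[of y'] have "m / 2 * (norm (y - y'))\<^sup>2 \<le> 0" by simp
    thus "y' = y" using m by (simp add: mult_le_0_iff)
  qed
qed

subsection \<open>The Hessian of the penalized function\<close>

text \<open>The quadratic form \<open>q\<^sup>T (\<nabla>\<^sub>y\<^sup>2 W) q\<close>, using that the three arguments of \<open>V\<close> in \<open>W\<close> are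
  affine in \<open>y\<close> with linear parts \<open>I\<close>, \<open>I - u u\<^sup>T\<close> and \<open>u u\<^sup>T\<close>.\<close>

definition W_hess_form ::
  "real \<Rightarrow> real \<Rightarrow> (real^'n \<Rightarrow> real) \<Rightarrow> real^'n \<Rightarrow> real^'n \<Rightarrow> real^'n \<Rightarrow> real^'n \<Rightarrow> real" where
  "W_hess_form \<alpha> \<beta> V y x u q =
     (1 - \<alpha>) * (q \<bullet> (hess V y *v q))
     + \<alpha> * ((q - (u \<bullet> q) *\<^sub>R u) \<bullet> (hess V (y - (u \<bullet> (y - x)) *\<^sub>R u) *v (q - (u \<bullet> q) *\<^sub>R u)))
     - \<beta> * (((u \<bullet> q) *\<^sub>R u) \<bullet> (hess V (x + (u \<bullet> (y - x)) *\<^sub>R u) *v ((u \<bullet> q) *\<^sub>R u)))"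

text \<open>Along a line in \<open>y\<close> each argument of \<open>V\<close> moves on a line too,
  with velocities \<open>q\<close>, \<open>q1\<close> and \<open>q2\<close>.\<close>

lemma W_line_derivatives:
  fixes V :: "real^'n \<Rightarrow> real"
  assumes C2: "Ck 2 V"
  shows "\<exists>D. \<forall>t. ((\<lambda>t. W \<alpha> \<beta> V (p + t *\<^sub>R q) x u) has_real_derivative D t) (at t) \<and>
    (D has_real_derivative W_hess_form \<alpha> \<beta> V (p + t *\<^sub>R q) x u q) (at t)"
proof -
  define q2 where "q2 = (u \<bullet> q) *\<^sub>R u"
  define q1 where "q1 = q - q2"
  define p1 p2 where "p1 = p - (u \<bullet> (p - x)) *\<^sub>R u" and "p2 = x + (u \<bullet> (p - x)) *\<^sub>R u"
  have a1: "p + t *\<^sub>R q - (u \<bullet> (p + t *\<^sub>R q - x)) *\<^sub>R u = p1 + t *\<^sub>R q1" for t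
    by (simp add: p1_def q1_def q2_def inner_diff_right inner_add_right algebra_simps)
  have a2: "x + (u \<bullet> (p + t *\<^sub>R q - x)) *\<^sub>R u = p2 + t *\<^sub>R q2" for t
    by (simp add: p2_def q2_def inner_diff_right inner_add_right algebra_simps)
  show ?thesis
    unfolding W_def W_hess_form_def a1 a2 q2_def[symmetric] q1_def[symmetric]
    by (rule exI[of _ "\<lambda>t. (1 - \<alpha>) * (q \<bullet> grad V (p + t *\<^sub>R q)) + \<alpha> * (q1 \<bullet> grad V (p1 + t *\<^sub>R q1))
          - \<beta> * (q2 \<bullet> grad V (p2 + t *\<^sub>R q2))"])
      (intro allI conjI DERIV_add DERIV_diff DERIV_cmult line_deriv line_deriv2 C2)
qed

lemma W_differentiable:
  fixes V :: "real^'n \<Rightarrow> real"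
  assumes C2: "Ck 2 V"
  shows "(\<lambda>y. W \<alpha> \<beta> V y x u) differentiable (at y)"
proof -
  have V: "V differentiable (at z)" for z
    using GDERIV_grad[OF C2] unfolding gderiv_def differentiable_def by blast
  have l: "(\<lambda>y. (u \<bullet> (y - x)) *\<^sub>R u) differentiable (at y)"
    unfolding differentiable_def by (rule exI) (auto intro!: derivative_eq_intros)
  show ?thesis unfolding W_def
    by (intro differentiable_add differentiable_diff differentiable_mult differentiable_const V
        differentiable_compose[of V] differentiable_ident l)
qed

text \<open>Homogeneity reduces lower bounds to unit vectors \<open>q\<close>, where compactness
  applies.\<close>

lemma W_hess_form_scaleR: "W_hess_form \<alpha> \<beta> V y x u (s *\<^sub>R q) = s\<^sup>2 * W_hess_form \<alpha> \<beta> V y x u q"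
proof -
  have "(u \<bullet> (s *\<^sub>R q)) *\<^sub>R u = s *\<^sub>R ((u \<bullet> q) *\<^sub>R u)"
    "s *\<^sub>R q - s *\<^sub>R ((u \<bullet> q) *\<^sub>R u) = s *\<^sub>R (q - (u \<bullet> q) *\<^sub>R u)" by (simp_all add: algebra_simps)
  note * = this
  have sc: "(s *\<^sub>R z) \<bullet> (A *v (s *\<^sub>R z)) = s\<^sup>2 * (z \<bullet> (A *v z))" for z and A :: "real^'n^'n"
    by (simp add: matrix_vector_mult_scaleR power2_eq_square)
  show ?thesis unfolding W_hess_form_def * sc by (simp only: ring_distribs mult_ac)
qed

text \<open>Both projections of \<open>q\<close> are no longer than \<open>q\<close>, so each term
  costs at most its coefficient times \<open>B * (norm q)\<^sup>2\<close>. This is the bound used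
  away from the diagonal.\<close>

lemma W_hess_form_lower_bound:
  fixes V :: "real^'n \<Rightarrow> real"
  assumes B: "\<And>x v. \<bar>v \<bullet> (hess V x *v v)\<bar> \<le> B * (norm v)\<^sup>2" and u: "norm u = 1"
  shows "- ((\<bar>1 - \<alpha>\<bar> + \<bar>\<alpha>\<bar> + \<bar>\<beta>\<bar>) * B) * (norm q)\<^sup>2 \<le> W_hess_form \<alpha> \<beta> V y x u q"
proof -
  have B0: "0 \<le> B" using B[of u 0] u by simp
  have uu: "u \<bullet> u = 1" using u by (simp add: norm_eq_1)
  have "(norm (q - (u \<bullet> q) *\<^sub>R u))\<^sup>2 = (norm q)\<^sup>2 - (u \<bullet> q)\<^sup>2"
    unfolding power2_norm_eq_inner
    by (simp add: inner_diff_left inner_diff_right uu inner_commute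
        power2_eq_square)
  hence 1: "(norm (q - (u \<bullet> q) *\<^sub>R u))\<^sup>2 \<le> (norm q)\<^sup>2" by simp
  have "\<bar>u \<bullet> q\<bar> \<le> norm q" using Cauchy_Schwarz_ineq2[of u q] u by simp
  hence 2: "(norm ((u \<bullet> q) *\<^sub>R u))\<^sup>2 \<le> (norm q)\<^sup>2"
    using u by (intro power_mono) auto
  have form: "- (\<bar>c\<bar> * B * (norm q)\<^sup>2) \<le> c * (v \<bullet> (hess V z *v v))"
    if "(norm v)\<^sup>2 \<le> (norm q)\<^sup>2" for c v z
  proof -
    have "\<bar>v \<bullet> (hess V z *v v)\<bar> \<le> B * (norm q)\<^sup>2"
      using B[of v z] mult_left_mono[OF that B0] by linarith
    hence "\<bar>c * (v \<bullet> (hess V z *v v))\<bar> \<le> \<bar>c\<bar> * (B * (norm q)\<^sup>2)"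
      by (simp add: abs_mult mult_left_mono)
    thus ?thesis by (simp add: abs_le_iff mult.assoc)
  qed
  show ?thesis unfolding W_hess_form_def
    using form[of q "1 - \<alpha>" y] form[OF 1, of \<alpha>, of "y - (u \<bullet> (y - x)) *\<^sub>R u"]
      form[OF 2, of "- \<beta>", of "x + (u \<bullet> (y - x)) *\<^sub>R u"]
    by (simp add: algebra_simps)
qed

text \<open>At \<open>y = x\<close> all three Hessians agree. With
  \<open>q = q' + a *\<^sub>R u\<close> the mixed terms vanish, since \<open>u\<close> is an
  eigenvector, and the form is that of \<open>q'\<close> plus
  \<open>(\<alpha> + \<beta> - 1) * (a\<^sup>2 * (- m))\<close>.\<close>

lemma W_hess_form_pos:
  fixes V :: "real^'n \<Rightarrow> real"
  assumes sym: "transpose (hess V x) = hess V x" and x: "x \<in> index1_region V"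
    and ab: "\<alpha> + \<beta> > 1"
    and u: "norm u = 1" "hess V x *v u = (u \<bullet> (hess V x *v u)) *\<^sub>R u" "u \<bullet> (hess V x *v u) \<le> 0"
    and q: "q \<noteq> 0"
  shows "0 < W_hess_form \<alpha> \<beta> V x x u q"
proof -
  define H where "H = hess V x"
  define m where "m = u \<bullet> (H *v u)"
  have pos: "\<forall>i\<in>{2..CARD('n)}. 0 < eigvals H ! (i - 1)" and neg: "eigvals H ! 0 < 0"
    using x by (auto simp: index1_region_def lam_def H_def)
  have symH: "transpose H = H" using sym by (simp add: H_def)
  have Hu: "H *v u = m *\<^sub>R u" using u(2) by (simp add: H_def m_def)
  have m0: "m \<le> 0" using u(3) by (simp add: H_def m_def)
  have uu: "u \<bullet> u = 1" using u(1) by (simp add: norm_eq_1)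
  have orth: "0 < v \<bullet> (H *v v)" if "u \<bullet> v = 0" "v \<noteq> 0" for v
    by (rule index1_orthogonal_pos[OF symH pos u(1) Hu m0 that])
  \<comment> \<open>If \<open>m = 0\<close>, an eigenvector for the negative first eigenvalue would
    be orthogonal to \<open>u\<close>, where the form is positive.\<close>
  have m: "m < 0"
  proof (rule ccontr)
    assume "\<not> m < 0"
    hence m: "m = 0" using m0 by simp
    obtain w where w: "norm w = 1" "H *v w = (eigvals H ! 0) *\<^sub>R w"
      using eigvals_hd_eigenvector[OF symH] .
    have "(eigvals H ! 0) * (u \<bullet> w) = 0"
      using inner_symmetric_matrix[OF symH, of u w] by (simp add: Hu w m)
    hence "u \<bullet> w = 0" using neg by simp
    hence "0 < w \<bullet> (H *v w)" using w(1) by (intro orth) auto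
    thus False using w neg by (simp add: norm_eq_1)
  qed
  define a where "a = u \<bullet> q"
  define q' where "q' = q - a *\<^sub>R u"
  have uq': "u \<bullet> q' = 0" by (simp add: q'_def a_def inner_diff_right uu)
  have q_eq: "q = q' + a *\<^sub>R u" by (simp add: q'_def)
  have "u \<bullet> (H *v q') = 0"
    using inner_symmetric_matrix[OF symH, of u q'] uq' by (simp add: Hu)
  hence qHq: "q \<bullet> (H *v q) = q' \<bullet> (H *v q') + a\<^sup>2 * m"
    by (simp add: q_eq matrix_vector_right_distrib matrix_vector_mult_scaleR Hu inner_add_left
        inner_add_right uq' uu power2_eq_square inner_commute[of q' u])
  have "W_hess_form \<alpha> \<beta> V x x u q = q' \<bullet> (H *v q') + (\<alpha> + \<beta> - 1) * (a\<^sup>2 * (- m))"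
    by (simp add: W_hess_form_def H_def[symmetric] a_def[symmetric] q'_def[symmetric] qHq
        matrix_vector_mult_scaleR Hu uu power2_eq_square) (simp add: algebra_simps)
  moreover have "0 \<le> (\<alpha> + \<beta> - 1) * (a\<^sup>2 * (- m))"
    using ab m by (intro mult_nonneg_nonneg) auto
  moreover have "0 < (\<alpha> + \<beta> - 1) * (a\<^sup>2 * (- m))" if "q' = 0"
    using ab m q q_eq that by (intro mult_pos_pos) auto
  ultimately show ?thesis using orth[OF uq'] by (cases "q' = 0") auto
qed

lemma v1_eigenvector:
  fixes V :: "real^'n \<Rightarrow> real"
  assumes sym: "transpose (hess V x) = hess V x"
  shows "norm (v1 V x) = 1" "hess V x *v v1 V x = lam V 1 x *\<^sub>R v1 V x"
proof -
  obtain w where "norm w = 1 \<and> hess V x *v w = lam V 1 x *\<^sub>R w"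
    using eigvals_hd_eigenvector[OF sym] unfolding lam_def by auto
  hence "norm (v1 V x) = 1 \<and> hess V x *v v1 V x = lam V 1 x *\<^sub>R v1 V x"
    unfolding v1_def by (rule someI)
  thus "norm (v1 V x) = 1" "hess V x *v v1 V x = lam V 1 x *\<^sub>R v1 V x" by auto
qed

text \<open>Since \<open>v1 V\<close> need not be continuous, compactness is applied to the closed set of all
  unit eigenvectors with non-positive eigenvalue over \<open>\<Omega>\<close>, which contains \<open>(x, v1 V x)\<close>.\<close>

lemma W_hess_form_pos_near_diagonal:
  fixes V :: "real^'n \<Rightarrow> real"
  assumes C2: "Ck 2 V" and comp: "compact \<Omega>" and sub: "\<Omega> \<subseteq> index1_region V"
    and ab: "\<alpha> + \<beta> > 1"
  obtains \<epsilon> c where "0 < \<epsilon>" "0 < c"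
    "\<And>x y q. x \<in> \<Omega> \<Longrightarrow> norm (y - x) < \<epsilon> \<Longrightarrow> c * (norm q)\<^sup>2 \<le> W_hess_form \<alpha> \<beta> V y x (v1 V x) q"
proof -
  have hess_comp: "continuous_on S (\<lambda>z. hess V (f z))" if "continuous_on S f"
    for S :: "'b::topological_space set" and f
    using continuous_on_compose2[OF continuous_on_hess[OF C2] that] by simp
  \<comment> \<open>Writing the eigenvalue as \<open>u \<bullet> (hess V x *v u)\<close> makes both
    conditions closed. The third component is a unit direction \<open>q\<close>.\<close>
  define K :: "((real^'n) \<times> (real^'n) \<times> (real^'n)) set" where
    "K = (\<Omega> \<times> sphere 0 1 \<times> sphere 0 1) \<inter>
      ({(x, u, q). hess V x *v u = (u \<bullet> (hess V x *v u)) *\<^sub>R u} \<inter>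
       {(x, u, q). u \<bullet> (hess V x *v u) \<le> 0})"
  have "closed {(x, u, q :: real^'n). hess V x *v u = (u \<bullet> (hess V x *v u)) *\<^sub>R u}"
    unfolding case_prod_unfold by (intro closed_Collect_eq continuous_intros hess_comp)
  moreover have "closed {(x, u, q :: real^'n). u \<bullet> (hess V x *v u) \<le> 0}"
    unfolding case_prod_unfold by (intro closed_Collect_le continuous_intros hess_comp)
  ultimately have K: "compact K"
    unfolding K_def by (intro compact_Int_closed closed_Int compact_Times comp compact_sphere)
  \<comment> \<open>The offset \<open>h = y - x\<close> is a separate variable, so the diagonal is
    \<open>h = 0\<close>.\<close>
  define F where "F z = (case z of (h, x, u, q) \<Rightarrow> W_hess_form \<alpha> \<beta> V (x + h) x u q)"
    for z :: "(real^'n) \<times> (real^'n) \<times> (real^'n) \<times> (real^'n)"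
  have contF: "continuous_on S F" for S
    unfolding F_def[abs_def] W_hess_form_def case_prod_unfold
    by (intro continuous_intros hess_comp)
  have F0: "0 < F (0, k)" if k: "k \<in> K" for k
  proof -
    obtain x u q where k': "k = (x, u, q)" by (cases k)
    have "x \<in> \<Omega>" using k by (simp add: K_def k')
    hence "0 < W_hess_form \<alpha> \<beta> V x x u q"
      using k sub by (intro W_hess_form_pos hess_symmetric C2 ab) (auto simp: K_def k')
    thus ?thesis by (simp add: F_def k')
  qed
  obtain c where c: "0 < c" "\<And>k. k \<in> K \<Longrightarrow> c \<le> F (0, k)"
  proof (cases "K = {}")
    case False
    have "continuous_on K (\<lambda>k. F (0, k))"
      by (rule continuous_on_compose2[OF contF[of UNIV]]) (auto intro!: continuous_intros)
    from continuous_attains_inf[OF K False this] F0 that show thesis by blast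
  qed (use that[of 1] in auto)
  have "uniformly_continuous_on (cball 0 1 \<times> K) F"
    by (intro compact_uniformly_continuous contF compact_Times compact_cball K)
  then obtain \<delta> where \<delta>: "0 < \<delta>" "\<And>z z'. z \<in> cball 0 1 \<times> K \<Longrightarrow> z' \<in> cball 0 1 \<times> K \<Longrightarrow>
      dist z' z < \<delta> \<Longrightarrow> dist (F z') (F z) < c / 2"
    unfolding uniformly_continuous_on_def using c(1) by (meson half_gt_zero)
  show thesis
  proof (rule that)
    \<comment> \<open>The cap 1 keeps \<open>y - x\<close> in the ball of uniform continuity; half
      of \<open>c\<close> is given up to the variation of \<open>F\<close>.\<close>
    show "0 < min \<delta> 1" "0 < c / 2" using \<delta> c by auto
    fix x y q assume x: "x \<in> \<Omega>" and y: "norm (y - x) < min \<delta> 1"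
    define u where "u = v1 V x"
    note v1 = v1_eigenvector[OF hess_symmetric[OF C2], of x, folded u_def]
    have uHu: "u \<bullet> (hess V x *v u) = lam V 1 x"
      using v1 by (simp add: norm_eq_1)
    have "lam V 1 x < 0" using x sub by (auto simp: index1_region_def)
    hence inK: "(x, u, e) \<in> K" if "norm e = 1" for e
      using x v1 uHu that by (simp add: K_def)
    show "c / 2 * (norm q)\<^sup>2 \<le> W_hess_form \<alpha> \<beta> V y x (v1 V x) q"
    proof (cases "q = 0")
      case True
      thus ?thesis using W_hess_form_scaleR[of \<alpha> \<beta> V y x "v1 V x" 0 q] by simp
    next
      case False
      define e where "e = q /\<^sub>R norm q"
      have e: "norm e = 1" "q = norm q *\<^sub>R e" using False by (simp_all add: e_def)
      have "dist (F (y - x, x, u, e)) (F (0, x, u, e)) < c / 2"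
        using inK[OF e(1)] y by (intro \<delta>(2)) (auto simp: dist_Pair_Pair dist_norm norm_minus_commute)
      hence "c / 2 \<le> F (y - x, x, u, e)"
        using c(2)[OF inK[OF e(1)]] by (simp add: dist_real_def abs_if split: if_splits)
      hence "c / 2 \<le> W_hess_form \<alpha> \<beta> V y x u e" by (simp add: F_def)
      hence "c / 2 * (norm q)\<^sup>2 \<le> (norm q)\<^sup>2 * W_hess_form \<alpha> \<beta> V y x u e"
        by (subst mult.commute) (intro mult_left_mono, auto)
      also have "\<dots> = W_hess_form \<alpha> \<beta> V y x u q"
        by (subst e(2)) (simp only: W_hess_form_scaleR)
      finally show ?thesis by (simp add: u_def)
    qed
  qed
qed

section \<open>Choice of the penalty threshold\<close>

theorem theorem4:
  fixes V :: "real^'n \<Rightarrow> real"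
    and d :: "real^'n \<Rightarrow> real^'n \<Rightarrow> real"
    and \<Omega> :: "(real^'n) set"
    and \<alpha> \<beta> :: real
  assumes "admissible_potential V"
    and "proximal d"
    and "compact \<Omega>" and "\<Omega> \<subseteq> index1_region V"
    and "\<alpha> + \<beta> > 1"
  shows "\<exists>\<rho>'\<ge>0. \<forall>\<rho>>\<rho>'. \<forall>x\<in>\<Omega>. Phi \<alpha> \<beta> V d \<rho> x \<noteq> {} \<and> is_singleton (Phi \<alpha> \<beta> V d \<rho> x)"
proof -
  have "Ck 3 V" using assms(1) by (simp add: admissible_potential_def)
  hence C2: "Ck 2 V" by (metis Ck_Suc_imp eval_nat_numeral(3))
  obtain lo up where bnd: "\<And>x. lo \<le> lambda_min (hess V x)" "\<And>x. lambda_max (hess V x) \<le> up"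
    using assms(1) unfolding admissible_potential_def by blast
  define B where "B = max \<bar>lo\<bar> \<bar>up\<bar>"
  have B: "\<bar>v \<bullet> (hess V x *v v)\<bar> \<le> B * (norm v)\<^sup>2" for x v
  proof -
    have "- B \<le> lambda_min (hess V x)" "lambda_max (hess V x) \<le> B"
      using bnd[of x] by (auto simp: B_def)
    hence "- B * (norm v)\<^sup>2 \<le> lambda_min (hess V x) * (norm v)\<^sup>2"
      "lambda_max (hess V x) * (norm v)\<^sup>2 \<le> B * (norm v)\<^sup>2"
      by (simp_all only: mult_right_mono zero_le_power2)
    thus ?thesis
      using lambda_min_rayleigh[OF hess_symmetric[OF C2], of x v]
        lambda_max_rayleigh[OF hess_symmetric[OF C2], of v x] by (simp add: abs_le_iff)
  qed
  define M where "M = (\<bar>1 - \<alpha>\<bar> + \<bar>\<alpha>\<bar> + \<bar>\<beta>\<bar>) * B"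
  have M: "0 \<le> M" unfolding M_def B_def by (intro mult_nonneg_nonneg) auto
  obtain \<epsilon> c where \<epsilon>: "0 < \<epsilon>" and c: "0 < c" and near:
    "\<And>x y q. x \<in> \<Omega> \<Longrightarrow> norm (y - x) < \<epsilon> \<Longrightarrow> c * (norm q)\<^sup>2 \<le> W_hess_form \<alpha> \<beta> V y x (v1 V x) q"
    using W_hess_form_pos_near_diagonal[OF C2 assms(3-5)] by blast
  have d2: "Ck 2 (d x)" and d0: "hess (d x) x = 0" for x
    using assms(2) by (auto simp: proximal_def)
  have dl: "\<exists>l>0. \<forall>x y. e \<le> norm (x - y) \<longrightarrow> l \<le> lambda_min (hess (d x) y)" if "e > 0" for e
    using assms(2) that unfolding proximal_def by blast
  have dray: "l * (norm q)\<^sup>2 \<le> q \<bullet> (hess (d x) y *v q)" if "l \<le> lambda_min (hess (d x) y)" for l x y q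
    using mult_right_mono[OF that, of "(norm q)\<^sup>2"]
      lambda_min_rayleigh[OF hess_symmetric[OF d2], of x y q] by simp
  \<comment> \<open>Off the diagonal the distance of \<open>x\<close> and \<open>y\<close> itself
    serves as the radius in \<open>dl\<close>; at \<open>x = y\<close> the Hessian vanishes.\<close>
  have dpsd: "0 \<le> q \<bullet> (hess (d x) y *v q)" for x y q
  proof (cases "x = y")
    case True
    thus ?thesis by (simp add: d0)
  next
    case False
    then obtain l where "0 < l" "l \<le> lambda_min (hess (d x) y)"
      using dl[of "norm (x - y)"] by auto
    thus ?thesis using dray[of l x y q] by (smt (verit) mult_nonneg_nonneg zero_le_power2)
  qed
  obtain l where l: "0 < l" "\<And>x y. \<epsilon> \<le> norm (x - y) \<Longrightarrow> l \<le> lambda_min (hess (d x) y)"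
    using dl[OF \<epsilon>] by blast
  \<comment> \<open>The threshold gives \<open>\<rho> * l \<ge> M + 1\<close>: away from the
    diagonal the penalty outweighs the loss \<open>M\<close> and leaves curvature at least 1. It is
    independent of \<open>x\<close>.\<close>
  have "Phi \<alpha> \<beta> V d \<rho> x \<noteq> {} \<and> is_singleton (Phi \<alpha> \<beta> V d \<rho> x)"
    if \<rho>: "\<rho> > (M + 1) / l" and x: "x \<in> \<Omega>" for \<rho> x
  proof -
    define u where "u = v1 V x"
    define f where "f y = W_pen \<alpha> \<beta> V d \<rho> y x u" for y
    have u: "norm u = 1" unfolding u_def by (rule v1_eigenvector[OF hess_symmetric[OF C2]])
    have \<rho>l: "M + 1 \<le> \<rho> * l" using \<rho> l(1) by (simp add: field_simps)
    have \<rho>0: "0 < \<rho>" using \<rho> M l(1) by (smt (verit) divide_nonneg_pos)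
    \<comment> \<open>The modulus is \<open>c\<close> near the diagonal and 1 away from it.\<close>
    define m where "m = min c 1"
    have hess_bound: "m * (norm q)\<^sup>2 \<le> W_hess_form \<alpha> \<beta> V y x u q + \<rho> * (q \<bullet> (hess (d x) y *v q))" for y q
    proof (cases "norm (y - x) < \<epsilon>")
      case True
      have "m * (norm q)\<^sup>2 \<le> c * (norm q)\<^sup>2" by (simp add: m_def mult_right_mono)
      thus ?thesis using near[OF x True, of q] mult_nonneg_nonneg[of \<rho>, OF _ dpsd[of q x y]] \<rho>0
        by (simp add: u_def)
    next
      case False
      hence "l * (norm q)\<^sup>2 \<le> q \<bullet> (hess (d x) y *v q)"
        by (intro dray l(2)) (simp add: norm_minus_commute)
      hence "\<rho> * (l * (norm q)\<^sup>2) \<le> \<rho> * (q \<bullet> (hess (d x) y *v q))"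
        using \<rho>0 by (intro mult_left_mono) auto
      moreover have "(M + 1) * (norm q)\<^sup>2 \<le> (\<rho> * l) * (norm q)\<^sup>2"
        by (rule mult_right_mono[OF \<rho>l]) simp
      moreover have "- M * (norm q)\<^sup>2 \<le> W_hess_form \<alpha> \<beta> V y x u q"
        unfolding M_def by (rule W_hess_form_lower_bound[OF B u])
      moreover have "m * (norm q)\<^sup>2 \<le> 1 * (norm q)\<^sup>2" by (rule mult_right_mono) (auto simp: m_def)
      ultimately show ?thesis by (simp add: algebra_simps)
    qed
    have "\<exists>!y. \<forall>z. f y \<le> f z"
    proof (rule strongly_convex_unique_minimizer)
      show "0 < m" using c by (simp add: m_def)
      have "d x differentiable (at y)" for y
        using GDERIV_grad[OF d2] unfolding gderiv_def differentiable_def by blast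
      thus "f differentiable (at y)" for y
        unfolding f_def W_pen_def
        by (intro differentiable_add differentiable_mult differentiable_const W_differentiable C2) auto
      fix p q
      obtain D where D: "\<And>t. ((\<lambda>t. W \<alpha> \<beta> V (p + t *\<^sub>R q) x u) has_real_derivative D t) (at t)"
        "\<And>t. (D has_real_derivative W_hess_form \<alpha> \<beta> V (p + t *\<^sub>R q) x u q) (at t)"
        using W_line_derivatives[OF C2] by metis
      show "\<exists>D D2. \<forall>t. ((\<lambda>t. f (p + t *\<^sub>R q)) has_real_derivative D t) (at t) \<and>
        (D has_real_derivative D2 t) (at t) \<and> m * (norm q)\<^sup>2 \<le> D2 t"
        unfolding f_def W_pen_def
        by (rule exI[of _ "\<lambda>t. D t + \<rho> * (q \<bullet> grad (d x) (p + t *\<^sub>R q))"],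
            rule exI[of _ "\<lambda>t. W_hess_form \<alpha> \<beta> V (p + t *\<^sub>R q) x u q
              + \<rho> * (q \<bullet> (hess (d x) (p + t *\<^sub>R q) *v q))"])
          (intro allI conjI DERIV_add DERIV_cmult D line_deriv line_deriv2 d2 hess_bound)
    qed
    then obtain y where "Phi \<alpha> \<beta> V d \<rho> x = {y}"
      unfolding Phi_def f_def u_def by blast
    thus ?thesis by simp
  qed
  moreover have "0 \<le> (M + 1) / l" using M l(1) by simp
  ultimately show ?thesis by blast
qed

end
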